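(* For every $n\ge1$, the completion of $\mathbb{Z}_2[\xi_1,\dots,\xi_n]$ in the linear transformation norm is the Tate algebra in $n$ variables over $\mathbb{Z}_2$: $$\widehat{\mathbb{Z}_2[\xi_1,\dots,\xi_n]}_L=T_n(\mathbb{Z}_2).$$
   Context: $\mathbb{Z}_2$ is the ring of dyadic ($2$-adic) integers, $\mathbb{Q}_2$ its fraction field with dyadic absolute value $|\cdot|_2$. $\mathbb{Z}_2[\xi_1,\dots,\xi_n]$ is graded by $\deg\xi_i=1$. $Jq$ is the $\mathbb{Z}_2$-algebra endomorphism with $Jq(1)=1$, $Jq(\xi_i)=\xi_i+\xi_i^2$. For $k\ge0$, $Jq^k$ is the $\mathbb{Z}_2$-linear map raising degree by $k$ obtained, on each degree $d$, by restricting $Jq$ to degree $d$ and projecting onto degree $d+k$ (extended $\mathbb{Q}_2$-linearly to $\mathbb{Q}_2[\xi_1,\dots,\xi_n]$). The dyadic Steenrod algebra $\mathcal{J}_2$ is the $\mathbb{Z}_2$-algebra generated under composition by the $Jq^k$, $k\ge0$, two elements being equal when they agree as operators on $\mathbb{Z}_2[\xi_1,\dots,\xi_n]$ for every $n$. For a polynomial $f=\sum_J a_J\xi^J$ over $\mathbb{Q}_2$ ($J$ running over finitely many multi-indices, $\xi^J=\xi_1^{j_1}\cdots\xi_n^{j_n}$), $\|f\|_2=\max_J|a_J|_2$. The linear transformation norm of $\theta\in\mathcal{J}_2$ is $\|\theta\|_L=\inf\{c\ge0 : \|\theta(f)\|_2\le c\|f\|_2 \text{ for all } f\in\mathbb{Q}_2[\xi_1,\dots,\xi_n]\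 (\text{all } n)\}$, and $B_L(0,r)=\{\theta\in\mathcal{J}_2:\|\theta\|_L<r\}$. For $B\subseteq\mathcal{J}_2$ and $M=\mathbb{Z}_2[\xi_1,\dots,\xi_n]$, $BM$ is the set of finite sums $\sum_i\theta_i(f_i)$, $\theta_i\in B$, $f_i\in M$. The completion $\widehat{M}_L$ of $M=\mathbb{Z}_2[\xi_1,\dots,\xi_n]$ is the inverse limit of the abelian groups $M/B_L(0,\tfrac1{2^k})M$, $k\ge0$, with the natural projections. The Tate algebra is $T_n(\mathbb{Z}_2)=\{\sum_J a_J\xi^J : a_J\in\mathbb{Z}_2,\ |a_J|_2\to0\text{ as }|J|=j_1+\cdots+j_n\to\infty\}$. *)

theory Defs
  imports
    Complex_Main
    "HOL-Computational_Algebra.Fraction_Field"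
    "HOL-Library.Poly_Mapping"
    "HOL-Algebra.Product_Groups"
begin

section \<open>The dyadic integers\<close>

text \<open>The ring of dyadic integers is the inverse limit of the rings of integers modulo \<open>2 ^ k\<close>;
  \<open>residue x k\<close> is the residue of \<open>x\<close> modulo \<open>2 ^ k\<close>, normalised to lie in \<open>{0..<2 ^ k}\<close>.\<close>

typedef dyadic_int =
  "{x :: nat \<Rightarrow> int. \<forall>k. x k \<in> {0..<2 ^ k} \<and> x (Suc k) mod 2 ^ k = x k}"
  morphisms residue Abs_dyadic_int
  by (rule exI[of _ "\<lambda>_. 0"]) simp

setup_lifting type_definition_dyadic_int

lemma residue_bounds: "0 \<le> residue x k" "residue x k < 2 ^ k"
  using residue[of x] by auto

lemma residue_0 [simp]: "residue x 0 = 0"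
  using residue_bounds[of x 0] by simp

lemma residue_mod_self [simp]: "residue x k mod 2 ^ k = residue x k"
  by (simp add: residue_bounds)

lemma residue_Suc: "residue x (Suc k) mod 2 ^ k = residue x k"
  using residue[of x] by auto

lemma int_power_of_2_dvd_mult:
  "2 ^ (a + b) dvd (x :: int) * y \<Longrightarrow> 2 ^ a dvd x \<or> 2 ^ b dvd y"
proof (induction a arbitrary: x)
  case (Suc a)
  show ?case
  proof (cases "even x")
    case True
    then obtain x' where "x = 2 * x'" by blast
    with Suc show ?thesis by (simp add: mult.assoc)
  next
    case False
    then have "coprime (2 ^ (Suc a + b)) x" by simp
    with Suc.prems have "2 ^ (Suc a + b) dvd y"
      by (simp only: coprime_dvd_mult_right_iff)
    then show ?thesis by (meson dvd_trans le_add2 le_imp_power_dvd)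
  qed
qed simp

lemma mod_power_Suc: "(a :: int) mod 2 ^ Suc k mod 2 ^ k = a mod 2 ^ k"
  by (rule mod_mod_cancel) simp

lemma residue_mod: "j \<le> k \<Longrightarrow> residue x k mod 2 ^ j = residue x j"
proof (induction k)
  case (Suc k)
  show ?case
  proof (cases "j = Suc k")
    case False
    with Suc.prems have "j \<le> k" by simp
    have "residue x (Suc k) mod 2 ^ j = residue x (Suc k) mod 2 ^ k mod 2 ^ j"
      using \<open>j \<le> k\<close> by (simp add: mod_mod_cancel le_imp_power_dvd)
    also have "\<dots> = residue x j"
      using Suc.IH \<open>j \<le> k\<close> by (simp add: residue_Suc)
    finally show ?thesis .
  qed (use residue_mod_self in blast)
qed simp

lemma dyadic_int_eqI: "(\<And>k. residue x k = residue y k) \<Longrightarrow> x = y"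
  by (metis ext residue_inject)

instantiation dyadic_int :: comm_ring_1
begin

lift_definition zero_dyadic_int :: dyadic_int is "\<lambda>_. 0" by simp

lift_definition one_dyadic_int :: dyadic_int is "\<lambda>k. 1 mod 2 ^ k"
  by (auto simp: mod_power_Suc simp del: power_Suc)

lift_definition plus_dyadic_int :: "dyadic_int \<Rightarrow> dyadic_int \<Rightarrow> dyadic_int"
  is "\<lambda>x y k. (x k + y k) mod 2 ^ k"
  unfolding mod_power_Suc by (auto intro: mod_add_cong)

lift_definition times_dyadic_int :: "dyadic_int \<Rightarrow> dyadic_int \<Rightarrow> dyadic_int"
  is "\<lambda>x y k. (x k * y k) mod 2 ^ k"
  unfolding mod_power_Suc by (auto intro: mod_mult_cong)

lift_definition uminus_dyadic_int :: "dyadic_int \<Rightarrow> dyadic_int"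
  is "\<lambda>x k. (- x k) mod 2 ^ k"
  unfolding mod_power_Suc by (auto intro: mod_minus_cong)

definition minus_dyadic_int :: "dyadic_int \<Rightarrow> dyadic_int \<Rightarrow> dyadic_int"
  where "minus_dyadic_int x y = x + - y"

instance
proof
  fix a b c :: dyadic_int
  show "a + b + c = a + (b + c)"
    by (rule dyadic_int_eqI) (simp add: plus_dyadic_int.rep_eq mod_simps add.assoc)
  show "a + b = b + a"
    by (rule dyadic_int_eqI) (simp add: plus_dyadic_int.rep_eq add.commute)
  show "0 + a = a"
    by (rule dyadic_int_eqI) (simp add: plus_dyadic_int.rep_eq zero_dyadic_int.rep_eq)
  show "- a + a = 0"
    by (rule dyadic_int_eqI)
      (simp add: plus_dyadic_int.rep_eq zero_dyadic_int.rep_eq uminus_dyadic_int.rep_eq mod_simps)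
  show "a - b = a + - b"
    by (simp add: minus_dyadic_int_def)
  show "a * b * c = a * (b * c)"
    by (rule dyadic_int_eqI) (simp add: times_dyadic_int.rep_eq mod_simps mult.assoc)
  show "a * b = b * a"
    by (rule dyadic_int_eqI) (simp add: times_dyadic_int.rep_eq mult.commute)
  show "1 * a = a"
    by (rule dyadic_int_eqI) (simp add: times_dyadic_int.rep_eq one_dyadic_int.rep_eq mod_mult_left_eq)
  show "(a + b) * c = a * c + b * c"
    by (rule dyadic_int_eqI)
      (simp add: times_dyadic_int.rep_eq plus_dyadic_int.rep_eq mod_simps distrib_right)
  have "residue (0 :: dyadic_int) 1 \<noteq> residue 1 1"
    by (simp add: zero_dyadic_int.rep_eq one_dyadic_int.rep_eq)
  then show "(0 :: dyadic_int) \<noteq> 1"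
    by metis
qed

end

instance dyadic_int :: idom
proof
  fix x y :: dyadic_int
  assume "x \<noteq> 0" "y \<noteq> 0"
  then obtain a b where a: "residue x a \<noteq> 0" and b: "residue y b \<noteq> 0"
    by (metis dyadic_int_eqI zero_dyadic_int.rep_eq)
  define X Y where "X = residue x (a + b)" and "Y = residue y (a + b)"
  have na: "\<not> 2 ^ a dvd X"
    using a residue_mod[of a "a + b" x] by (simp add: X_def dvd_eq_mod_eq_0)
  have nb: "\<not> 2 ^ b dvd Y"
    using b residue_mod[of b "a + b" y] by (simp add: Y_def dvd_eq_mod_eq_0)
  have "\<not> 2 ^ (a + b) dvd X * Y"
    using na nb int_power_of_2_dvd_mult by blast
  then have "residue (x * y) (a + b) \<noteq> 0"
    by (simp add: times_dyadic_int.rep_eq X_def Y_def dvd_eq_mod_eq_0)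
  then show "x * y \<noteq> 0"
    by (metis zero_dyadic_int.rep_eq)
qed


lemma residue_power_of_2: "residue (2 ^ k) j = 2 ^ k mod 2 ^ j"
proof -
  have "residue (1 + 1) j = 2 mod 2 ^ j"
    by (simp only: plus_dyadic_int.rep_eq one_dyadic_int.rep_eq) (simp add: mod_simps)
  then have "residue 2 j = 2 mod 2 ^ j"
    by simp
  then show ?thesis
    by (induction k) (simp_all add: one_dyadic_int.rep_eq times_dyadic_int.rep_eq mod_simps)
qed

lemma power_of_2_dvd_iff: "2 ^ k dvd x \<longleftrightarrow> residue x k = 0"
proof
  assume "2 ^ k dvd x"
  then show "residue x k = 0"
    by (auto simp: times_dyadic_int.rep_eq residue_power_of_2)
next
  assume 0: "residue x k = 0"
  define y where "y j = residue x (j + k) div 2 ^ k" for j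
  have dvd: "2 ^ k dvd residue x (j + k)" for j
    using residue_mod[of k "j + k" x] 0 by (simp add: dvd_eq_mod_eq_0)
  have y: "2 ^ k * y j = residue x (j + k)" for j
    using dvd by (simp add: y_def)
  have "y j \<in> {0..<2 ^ j}" for j
  proof -
    have "0 \<le> 2 ^ k * y j" "2 ^ k * y j < 2 ^ k * 2 ^ j"
      using residue_bounds[of x "j + k"] by (simp_all only: y power_add) (simp_all add: mult.commute)
    then show ?thesis by (simp add: zero_le_mult_iff)
  qed
  moreover have "y (Suc j) mod 2 ^ j = y j" for j
  proof -
    have "2 ^ k * (y (Suc j) mod 2 ^ j) = (2 ^ k * y (Suc j)) mod (2 ^ k * 2 ^ j)"
      by (rule mult_mod_right)
    also have "\<dots> = 2 ^ k * y j"
      using residue_Suc[of x "j + k"]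
      by (simp only: y add_Suc power_add[symmetric] add.commute[of k j])
    finally show ?thesis by simp
  qed
  ultimately have res: "residue (Abs_dyadic_int y) = y"
    by (simp add: Abs_dyadic_int_inverse)
  have "x = 2 ^ k * Abs_dyadic_int y"
  proof (rule dyadic_int_eqI)
    fix j
    have "residue x j = residue x (j + k) mod 2 ^ j"
      by (simp add: residue_mod)
    then show "residue x j = residue (2 ^ k * Abs_dyadic_int y) j"
      by (simp add: times_dyadic_int.rep_eq residue_power_of_2 res mod_simps y)
  qed
  then show "2 ^ k dvd x" by simp
qed

section \<open>The dyadic absolute value\<close>

definition dyadic_int_abs :: "dyadic_int \<Rightarrow> real"
  where "dyadic_int_abs x = (if x = 0 then 0 else (1 / 2) ^ (GREATEST k. 2 ^ k dvd x))"

lemma dyadic_int_absI: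
  assumes "\<not> 2 dvd u"
  shows "dyadic_int_abs (2 ^ k * u) = (1 / 2) ^ k"
proof -
  have two: "(2 :: dyadic_int) ^ j \<noteq> 0" for j
    using power_of_2_dvd_iff[of "Suc j" "2 ^ j"]
    by (auto simp: residue_power_of_2)
  have "(GREATEST j. 2 ^ j dvd 2 ^ k * u) = k"
  proof (rule Greatest_equality)
    fix j
    assume "2 ^ j dvd 2 ^ k * u"
    show "j \<le> k"
    proof (rule ccontr)
      assume "\<not> j \<le> k"
      then have "2 ^ k * 2 dvd (2 ^ j :: dyadic_int)"
        by (metis le_imp_power_dvd not_less_eq_eq power_Suc2)
      with \<open>2 ^ j dvd 2 ^ k * u\<close> have "2 ^ k * 2 dvd 2 ^ k * u"
        by (rule dvd_trans[rotated])
      with assms two[of k] show False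
        by (simp only: dvd_mult_cancel_left) simp
    qed
  qed simp
  moreover have "2 ^ k * u \<noteq> 0"
    using assms two[of k] by (metis dvd_0_right mult_eq_0_iff)
  ultimately show ?thesis
    unfolding dyadic_int_abs_def by (simp only: if_False)
qed

lemma dyadic_int_decompose:
  assumes "x \<noteq> 0"
  obtains k u where "x = 2 ^ k * u" "\<not> 2 dvd (u :: dyadic_int)"
proof -
  obtain a where a: "residue x a \<noteq> 0"
    using assms by (metis dyadic_int_eqI zero_dyadic_int.rep_eq)
  have bound: "k \<le> a" if "2 ^ k dvd x" for k
  proof (rule ccontr)
    assume "\<not> k \<le> a"
    then have "2 ^ a dvd x"
      using that by (meson dvd_trans le_imp_power_dvd nat_le_linear)
    with a show False by (simp add: power_of_2_dvd_iff)
  qed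
  define k where "k = (GREATEST k. 2 ^ k dvd x)"
  have "2 ^ k dvd x"
    unfolding k_def by (rule GreatestI_nat[of _ 0 a]) (use bound in auto)
  then obtain u where u: "x = 2 ^ k * u" by blast
  have "\<not> 2 dvd u"
  proof
    assume "2 dvd u"
    then have "2 ^ Suc k dvd x" by (auto simp: u)
    then have "Suc k \<le> k"
      unfolding k_def by (rule Greatest_le_nat) (use bound in auto)
    then show False by simp
  qed
  with u show thesis by (rule that)
qed

lemma dyadic_int_abs_mult: "dyadic_int_abs (x * y) = dyadic_int_abs x * dyadic_int_abs y"
proof (cases "x = 0 \<or> y = 0")
  case False
  then obtain k u l w where u: "x = 2 ^ k * u" "\<not> 2 dvd u" and w: "y = 2 ^ l * w" "\<not> 2 dvd w"
    using dyadic_int_decompose by metis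
  have res: "2 dvd z \<longleftrightarrow> residue z 1 = 0" for z
    using power_of_2_dvd_iff[of 1 z] by simp
  have "residue u 1 = 1" "residue w 1 = 1"
    using u(2) w(2) residue_bounds[of u 1] residue_bounds[of w 1] by (auto simp: res)
  then have "\<not> 2 dvd u * w"
    by (simp add: res times_dyadic_int.rep_eq)
  from dyadic_int_absI[OF this, of "k + l"] show ?thesis
    by (metis u w dyadic_int_absI power_add mult.assoc mult.left_commute)
qed (auto simp: dyadic_int_abs_def)

type_synonym dyadic_rat = "dyadic_int fract"

lift_definition dyadic_abs :: "dyadic_rat \<Rightarrow> real"
  is "\<lambda>(a, b). dyadic_int_abs a / dyadic_int_abs b"
proof -
  fix p q :: "dyadic_int \<times> dyadic_int"
  obtain a b c d where pq: "p = (a, b)" "q = (c, d)" by (metis surj_pair)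
  assume "fractrel p q"
  then have nz: "b \<noteq> 0" "d \<noteq> 0" and "a * d = c * b" by (simp_all add: pq)
  then have "dyadic_int_abs a * dyadic_int_abs d = dyadic_int_abs c * dyadic_int_abs b"
    by (metis dyadic_int_abs_mult)
  moreover have "dyadic_int_abs b \<noteq> 0" "dyadic_int_abs d \<noteq> 0"
    using nz by (simp_all add: dyadic_int_abs_def)
  ultimately show "(case p of (a, b) \<Rightarrow> dyadic_int_abs a / dyadic_int_abs b) =
      (case q of (a, b) \<Rightarrow> dyadic_int_abs a / dyadic_int_abs b)"
    by (simp add: pq frac_eq_eq)
qed

definition dyadic_rat_of_int :: "dyadic_int \<Rightarrow> dyadic_rat"
  where "dyadic_rat_of_int a = Fract a 1"

lemma dyadic_abs_of_int: "dyadic_abs (dyadic_rat_of_int a) = dyadic_int_abs a"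
proof -
  have "\<not> 2 dvd (1 :: dyadic_int)"
    using power_of_2_dvd_iff[of 1 1] by (simp add: one_dyadic_int.rep_eq)
  from dyadic_int_absI[OF this, of 0] have "dyadic_int_abs 1 = 1" by simp
  then show ?thesis
    unfolding dyadic_rat_of_int_def by transfer simp
qed

section \<open>Polynomials\<close>

text \<open>Polynomials in the variables \<open>\<xi>\<^sub>0, \<xi>\<^sub>1, \<dots>\<close>, finitely many of which occur in each
  polynomial; \<open>poly_ring n\<close> below consists of those in \<open>\<xi>\<^sub>0, \<dots>, \<xi>\<^bsub>n - 1\<^esub>\<close>.  An operator on
  \<open>dyadic_int mpoly\<close> is thus a compatible family of operators on the polynomials in \<open>n\<close> variables,
  for every \<open>n\<close>.\<close>

type_synonym multi_index = "nat \<Rightarrow>\<^sub>0 nat"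
type_synonym 'a mpoly = "multi_index \<Rightarrow>\<^sub>0 'a"

definition mdeg :: "multi_index \<Rightarrow> nat"
  where "mdeg J = (\<Sum>i\<in>Poly_Mapping.keys J. Poly_Mapping.lookup J i)"

definition mconst :: "'a::zero \<Rightarrow> 'a mpoly"
  where "mconst c = Poly_Mapping.single 0 c"

lemma mconst_mult: "mconst (a * b :: dyadic_int) = mconst a * mconst b"
  by (simp add: mconst_def mult_single)

definition mvar :: "nat \<Rightarrow> dyadic_int mpoly"
  where "mvar i = Poly_Mapping.single (Poly_Mapping.single i 1) 1"

definition homogeneous_part :: "nat \<Rightarrow> dyadic_int mpoly \<Rightarrow> dyadic_int mpoly"
  where "homogeneous_part d f = (\<Sum>J\<in>{J \<in> Poly_Mapping.keys f. mdeg J = d}. Poly_Mapping.single J (Poly_Mapping.lookup f J))"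

definition poly_ring :: "nat \<Rightarrow> dyadic_int mpoly set"
  where "poly_ring n = {f. \<forall>J\<in>Poly_Mapping.keys f. Poly_Mapping.keys J \<subseteq> {..<n}}"

section \<open>The dyadic Steenrod algebra\<close>

definition Jq_total :: "dyadic_int mpoly \<Rightarrow> dyadic_int mpoly"
  where "Jq_total f =
    (\<Sum>J\<in>Poly_Mapping.keys f. mconst (Poly_Mapping.lookup f J) * (\<Prod>i\<in>Poly_Mapping.keys J. (mvar i + (mvar i)\<^sup>2) ^ Poly_Mapping.lookup J i))"

lemma Jq_total_superset:
  assumes "finite S" "Poly_Mapping.keys f \<subseteq> S"
  shows "Jq_total f = (\<Sum>J\<in>S. mconst (Poly_Mapping.lookup f J) *
    (\<Prod>i\<in>Poly_Mapping.keys J. (mvar i + (mvar i)\<^sup>2) ^ Poly_Mapping.lookup J i))"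
  unfolding Jq_total_def
  by (rule sum.mono_neutral_left) (use assms in \<open>auto simp: mconst_def in_keys_iff\<close>)

lemma Jq_total_single:
  "Jq_total (Poly_Mapping.single J c) =
    mconst c * (\<Prod>i\<in>Poly_Mapping.keys J. (mvar i + (mvar i)\<^sup>2) ^ Poly_Mapping.lookup J i)"
  by (subst Jq_total_superset[of "{J}"]) auto

lemma Jq_total_mconst: "Jq_total (mconst c) = mconst c"
  unfolding mconst_def by (subst Jq_total_single) (simp add: mconst_def)

lemma Jq_total_one: "Jq_total 1 = 1"
  using Jq_total_mconst[of 1] by (simp add: mconst_def)

lemma Jq_total_mvar: "Jq_total (mvar i) = mvar i + (mvar i)\<^sup>2"
  by (subst mvar_def, subst Jq_total_single) (simp add: mconst_def)

lemma Jq_total_add: "Jq_total (f + g) = Jq_total f + Jq_total g"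
  using keys_add[of f g]
  by (simp add: Jq_total_superset[of "Poly_Mapping.keys f \<union> Poly_Mapping.keys g"]
      lookup_add mconst_def single_add distrib_right sum.distrib)

lemma Jq_total_sum: "Jq_total (\<Sum>a\<in>A. f a) = (\<Sum>a\<in>A. Jq_total (f a))"
proof (induction A rule: infinite_finite_induct)
  case empty
  show ?case by (simp add: Jq_total_def)
qed (simp_all add: Jq_total_add Jq_total_def[of 0])

lemma mpoly_sum_monomials:
  "(\<Sum>J\<in>Poly_Mapping.keys f. Poly_Mapping.single J (Poly_Mapping.lookup f J)) = f"
proof (rule poly_mapping_eqI)
  fix K
  show "Poly_Mapping.lookup (\<Sum>J\<in>Poly_Mapping.keys f.
      Poly_Mapping.single J (Poly_Mapping.lookup f J)) K = Poly_Mapping.lookup f K"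
    by (simp add: lookup_sum lookup_single when_def sum.delta in_keys_iff)
qed

lemma Jq_total_mult: "Jq_total (f * g) = Jq_total f * Jq_total g"
proof -
  let ?m = "\<lambda>J. \<Prod>i\<in>Poly_Mapping.keys J. (mvar i + (mvar i)\<^sup>2) ^ Poly_Mapping.lookup J i"
  have m: "?m J = (\<Prod>i\<in>S. (mvar i + (mvar i)\<^sup>2) ^ Poly_Mapping.lookup J i)"
    if "finite S" "Poly_Mapping.keys J \<subseteq> S" for J S
    by (rule prod.mono_neutral_left) (use that in \<open>auto simp: in_keys_iff\<close>)
  have m_add: "?m (J + K) = ?m J * ?m K" for J K :: multi_index
  proof -
    let ?S = "Poly_Mapping.keys J \<union> Poly_Mapping.keys K"
    have "?m (J + K) = (\<Prod>i\<in>?S. (mvar i + (mvar i)\<^sup>2) ^ Poly_Mapping.lookup (J + K) i)"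
      by (rule m) (simp_all add: keys_add)
    moreover have "?m J = (\<Prod>i\<in>?S. (mvar i + (mvar i)\<^sup>2) ^ Poly_Mapping.lookup J i)"
      by (rule m) simp_all
    moreover have "?m K = (\<Prod>i\<in>?S. (mvar i + (mvar i)\<^sup>2) ^ Poly_Mapping.lookup K i)"
      by (rule m) simp_all
    ultimately show ?thesis
      by (simp only: lookup_add power_add prod.distrib)
  qed
  have *: "Jq_total (Poly_Mapping.single J a * Poly_Mapping.single K b) =
      Jq_total (Poly_Mapping.single J a) * Jq_total (Poly_Mapping.single K b)" for J K a b
    by (simp only: mult_single Jq_total_single m_add mconst_mult mult_ac)
  let ?t = "\<lambda>f J. Poly_Mapping.single J (Poly_Mapping.lookup f J)"
  have "Jq_total ((\<Sum>J\<in>Poly_Mapping.keys f. ?t f J) * (\<Sum>K\<in>Poly_Mapping.keys g. ?t g K)) =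
      Jq_total (\<Sum>J\<in>Poly_Mapping.keys f. ?t f J) * Jq_total (\<Sum>K\<in>Poly_Mapping.keys g. ?t g K)"
    by (simp only: sum_product Jq_total_sum *)
  then show ?thesis
    by (simp only: mpoly_sum_monomials)
qed

definition Jq :: "nat \<Rightarrow> dyadic_int mpoly \<Rightarrow> dyadic_int mpoly"
  where "Jq k f = (\<Sum>d\<in>mdeg ` Poly_Mapping.keys f. homogeneous_part (d + k) (Jq_total (homogeneous_part d f)))"

inductive_set dyadic_steenrod :: "(dyadic_int mpoly \<Rightarrow> dyadic_int mpoly) set"
  where
    Jq: "Jq k \<in> dyadic_steenrod"
  | id: "(\<lambda>f. f) \<in> dyadic_steenrod"
  | add: "\<theta> \<in> dyadic_steenrod \<Longrightarrow> \<eta> \<in> dyadic_steenrod \<Longrightarrow> (\<lambda>f. \<theta> f + \<eta> f) \<in> dyadic_steenrod"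
  | scale: "\<theta> \<in> dyadic_steenrod \<Longrightarrow> (\<lambda>f. mconst c * \<theta> f) \<in> dyadic_steenrod"
  | comp: "\<theta> \<in> dyadic_steenrod \<Longrightarrow> \<eta> \<in> dyadic_steenrod \<Longrightarrow> (\<lambda>f. \<theta> (\<eta> f)) \<in> dyadic_steenrod"

section \<open>The linear transformation norm\<close>

definition gauss_norm :: "dyadic_rat mpoly \<Rightarrow> real"
  where "gauss_norm f = Max (insert 0 ((\<lambda>J. dyadic_abs (Poly_Mapping.lookup f J)) ` Poly_Mapping.keys f))"

text \<open>The \<open>Q\<^sub>2\<close>-linear extension of a \<open>Z\<^sub>2\<close>-linear operator, which is determined by its values on the
  monomials.\<close>

definition rat_extension ::
    "(dyadic_int mpoly \<Rightarrow> dyadic_int mpoly) \<Rightarrow> dyadic_rat mpoly \<Rightarrow> dyadic_rat mpoly"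
  where "rat_extension \<theta> f =
    (\<Sum>J\<in>Poly_Mapping.keys f. mconst (Poly_Mapping.lookup f J) *
      Poly_Mapping.map dyadic_rat_of_int (\<theta> (Poly_Mapping.single J 1)))"

definition linear_norm :: "(dyadic_int mpoly \<Rightarrow> dyadic_int mpoly) \<Rightarrow> real"
  where "linear_norm \<theta> =
    Inf {c. 0 \<le> c \<and> (\<forall>f. gauss_norm (rat_extension \<theta> f) \<le> c * gauss_norm f)}"

definition linear_ball :: "real \<Rightarrow> (dyadic_int mpoly \<Rightarrow> dyadic_int mpoly) set"
  where "linear_ball r = {\<theta> \<in> dyadic_steenrod. linear_norm \<theta> < r}"

section \<open>The completion\<close>

definition operator_span ::
    "(dyadic_int mpoly \<Rightarrow> dyadic_int mpoly) set \<Rightarrow> dyadic_int mpoly set \<Rightarrow> dyadic_int mpoly set"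
  where "operator_span B M = {\<Sum>(\<theta>, f)\<leftarrow>ps. \<theta> f |ps. set ps \<subseteq> B \<times> M}"

definition poly_group :: "nat \<Rightarrow> dyadic_int mpoly monoid"
  where "poly_group n = \<lparr>carrier = poly_ring n, mult = (+), one = 0\<rparr>"

definition ball_span :: "nat \<Rightarrow> nat \<Rightarrow> dyadic_int mpoly set"
  where "ball_span n k = operator_span (linear_ball (1 / 2 ^ k)) (poly_ring n)"

text \<open>The projection sends a coset of \<open>ball_span n k\<close> to the coset of \<open>ball_span n j\<close>
  containing it, for \<open>j \<le> k\<close>.\<close>

definition quotient_projection :: "nat \<Rightarrow> nat \<Rightarrow> dyadic_int mpoly set \<Rightarrow> dyadic_int mpoly set"
  where "quotient_projection n j C = (\<Union>f\<in>C. ball_span n j #>\<^bsub>poly_group n\<^esub> f)"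

definition completion :: "nat \<Rightarrow> (nat \<Rightarrow> dyadic_int mpoly set) monoid"
  where "completion n =
    (let P = product_group UNIV (\<lambda>k. poly_group n Mod ball_span n k)
     in P\<lparr>carrier :=
       {x \<in> carrier P. \<forall>j k. j \<le> k \<longrightarrow> quotient_projection n j (x k) = x j}\<rparr>)"

definition to_completion :: "nat \<Rightarrow> dyadic_int mpoly \<Rightarrow> nat \<Rightarrow> dyadic_int mpoly set"
  where "to_completion n f = (\<lambda>k. ball_span n k #>\<^bsub>poly_group n\<^esub> f)"

section \<open>The Tate algebra\<close>

text \<open>Power series are coefficient families \<open>multi_index \<Rightarrow> dyadic_int\<close>; a polynomial \<open>f\<close> is
  the power series \<open>lookup f\<close>.\<close>

definition tate_algebra :: "nat \<Rightarrow> (multi_index \<Rightarrow> dyadic_int) set"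
  where "tate_algebra n =
    {a. (\<forall>J. a J \<noteq> 0 \<longrightarrow> Poly_Mapping.keys J \<subseteq> {..<n}) \<and>
        ((\<lambda>J. dyadic_int_abs (a J)) \<longlongrightarrow> 0) (filtercomap mdeg at_top)}"

definition tate_group :: "nat \<Rightarrow> (multi_index \<Rightarrow> dyadic_int) monoid"
  where "tate_group n = \<lparr>carrier = tate_algebra n, mult = (\<lambda>a b J. a J + b J), one = (\<lambda>_. 0)\<rparr>"

end

(* An operation in the dyadic Steenrod algebra maps integral polynomials to integral ones, so a norm
   below 1 / 2 ^ k forces all its values to be divisible by 2 ^ (k + 1); conversely, multiplication by
   2 ^ (k + 1) is an operation of norm below 1 / 2 ^ k.  Hence the ball spans the polynomials divisible
   by 2 ^ (k + 1), and the completion is the 2-adic one.  A power series has a polynomial representative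
   modulo every power of 2 exactly when it lies in the Tate algebra. *)

theory Submission
  imports Defs
begin

section \<open>The dyadic absolute value: discreteness and the ultrametric inequality\<close>

section \<open>Absolute values and norms\<close>

lemma dyadic_int_abs_nonneg: "0 \<le> dyadic_int_abs x"
  by (simp add: dyadic_int_abs_def)

lemma dyadic_int_abs_0 [simp]: "dyadic_int_abs 0 = 0"
  by (simp add: dyadic_int_abs_def)

lemma dyadic_int_abs_pos: "x \<noteq> 0 \<Longrightarrow> 0 < dyadic_int_abs x"
  by (simp add: dyadic_int_abs_def)

text \<open>With x = 2 ^ l * u and u odd, both sides say k \<le> l. This is the bridge from the
  metric to divisibility.\<close>

lemma dyadic_int_abs_le_iff: "dyadic_int_abs x \<le> (1 / 2) ^ k \<longleftrightarrow> 2 ^ k dvd x"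
proof (cases "x = 0")
  case False
  then obtain l u where x: "x = 2 ^ l * u" and u: "\<not> 2 dvd u"
    using dyadic_int_decompose by metis
  have nz: "(2 :: dyadic_int) ^ l \<noteq> 0"
    using False x by auto
  have "2 ^ k dvd x \<longleftrightarrow> k \<le> l"
  proof
    assume dvd: "2 ^ k dvd x"
    show "k \<le> l"
    proof (rule ccontr)
      assume "\<not> k \<le> l"
      then have "2 ^ l * 2 dvd (2 ^ k :: dyadic_int)"
        by (metis le_imp_power_dvd not_less_eq_eq power_Suc2)
      with dvd x have "2 ^ l * 2 dvd 2 ^ l * u"
        by (metis dvd_trans)
      with u nz show False
        by (simp only: dvd_mult_cancel_left) simp
    qed
  qed (simp add: x le_imp_power_dvd dvd_mult2)
  also have "\<dots> \<longleftrightarrow> dyadic_int_abs x \<le> (1 / 2) ^ k"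
    unfolding x dyadic_int_absI[OF u] by simp
  finally show ?thesis by simp
qed simp

text \<open>Nonzero absolute values are powers of 1/2, so a strict bound gains a full factor 2. This
  is the source of \<open>Suc k\<close> in the later moduli.\<close>

lemma dyadic_int_abs_less_imp_dvd:
  assumes "dyadic_int_abs x < 1 / 2 ^ k"
  shows "2 ^ Suc k dvd x"
proof (cases "x = 0")
  case False
  then obtain l u where x: "x = 2 ^ l * u" and u: "\<not> 2 dvd u"
    using dyadic_int_decompose by metis
  from assms have "(1 / 2 :: real) ^ l < (1 / 2) ^ k"
    by (simp add: x dyadic_int_absI[OF u] power_one_over)
  then have "Suc k \<le> l"
    by simp
  then show ?thesis
    unfolding x using le_imp_power_dvd dvd_mult2 by blast
qed simp

lemma dyadic_int_abs_le_1: "dyadic_int_abs x \<le> 1"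
  using dyadic_int_abs_le_iff[of x 0] by simp

lemma dyadic_int_abs_add: "dyadic_int_abs (x + y) \<le> max (dyadic_int_abs x) (dyadic_int_abs y)"
proof -
  \<comment> \<open>By symmetry y may be taken as the larger one; if its absolute value is (1/2) ^
    l, then 2 ^ l divides both summands.\<close>
  have *: "dyadic_int_abs (x + y) \<le> dyadic_int_abs y"
    if le: "dyadic_int_abs x \<le> dyadic_int_abs y" for x y
  proof (cases "y = 0")
    case True
    then have "x = 0"
      using le dyadic_int_abs_pos[of x] by force
    with True show ?thesis by simp
  next
    case False
    then obtain l where l: "dyadic_int_abs y = (1 / 2) ^ l"
      using dyadic_int_decompose dyadic_int_absI by metis
    then have "2 ^ l dvd x" "2 ^ l dvd y"
      using le dyadic_int_abs_le_iff[of x l] dyadic_int_abs_le_iff[of y l] by simp_all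
    then show ?thesis
      by (simp add: l dyadic_int_abs_le_iff)
  qed
  show ?thesis
    using *[of x y] *[of y x] by (auto simp: max_def add.commute)
qed

lemma dyadic_abs_Fract: "b \<noteq> 0 \<Longrightarrow> dyadic_abs (Fract a b) = dyadic_int_abs a / dyadic_int_abs b"
  by transfer simp

lemma dyadic_abs_0 [simp]: "dyadic_abs 0 = 0"
  by (simp add: Zero_fract_def dyadic_abs_Fract)

lemma dyadic_abs_mult: "dyadic_abs (x * y) = dyadic_abs x * dyadic_abs y"
  by (cases x; cases y) (simp add: dyadic_abs_Fract dyadic_int_abs_mult)

lemma dyadic_abs_add: "dyadic_abs (x + y) \<le> max (dyadic_abs x) (dyadic_abs y)"
proof (cases x; cases y)
  fix a b c d
  assume x: "x = Fract a b" "b \<noteq> 0" and y: "y = Fract c d" "d \<noteq> 0"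
  have pos: "0 < dyadic_int_abs (b * d)"
    using x y by (simp add: dyadic_int_abs_pos)
  have "dyadic_abs (x + y) = dyadic_int_abs (a * d + c * b) / dyadic_int_abs (b * d)"
    using x y by (simp add: dyadic_abs_Fract)
  also have "\<dots> \<le> max (dyadic_int_abs (a * d)) (dyadic_int_abs (c * b)) / dyadic_int_abs (b * d)"
    using dyadic_int_abs_add pos by (simp add: divide_right_mono)
  also have "\<dots> = max (dyadic_abs x) (dyadic_abs y)"
    using pos x y dyadic_int_abs_pos[of b] dyadic_int_abs_pos[of d]
    by (simp add: max_divide_distrib_right dyadic_abs_Fract dyadic_int_abs_mult)
  finally show ?thesis .
qed

lemma dyadic_abs_sum_le:
  assumes "0 \<le> c" "\<And>i. i \<in> A \<Longrightarrow> dyadic_abs (f i) \<le> c"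
  shows "dyadic_abs (\<Sum>i\<in>A. f i) \<le> c"
  using assms(2)
proof (induction A rule: infinite_finite_induct)
  case (insert i A)
  then show ?case
    using dyadic_abs_add[of "f i" "sum f A"] by fastforce
qed (use assms(1) in auto)

section \<open>Gauss norm and operator norm, read off from coefficients and monomials\<close>

lemma gauss_norm_le_iff:
  "gauss_norm f \<le> c \<longleftrightarrow> 0 \<le> c \<and> (\<forall>J. dyadic_abs (Poly_Mapping.lookup f J) \<le> c)"
proof -
  have "gauss_norm f \<le> c \<longleftrightarrow>
      0 \<le> c \<and> (\<forall>J\<in>Poly_Mapping.keys f. dyadic_abs (Poly_Mapping.lookup f J) \<le> c)"
    by (simp add: gauss_norm_def)
  also have "\<dots> \<longleftrightarrow> 0 \<le> c \<and> (\<forall>J. dyadic_abs (Poly_Mapping.lookup f J) \<le> c)"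
    by (metis dyadic_abs_0 in_keys_iff)
  finally show ?thesis .
qed

lemma lookup_mconst_mult:
  "Poly_Mapping.lookup (mconst c * f) J = (c :: 'a :: comm_ring_1) * Poly_Mapping.lookup f J"
  unfolding mconst_def mult_map_scale_conv_mult[symmetric]
  by (simp add: Poly_Mapping.map.rep_eq when_def)

lemma lookup_map_of_int:
  "Poly_Mapping.lookup (Poly_Mapping.map dyadic_rat_of_int f) J =
    dyadic_rat_of_int (Poly_Mapping.lookup f J)"
  by (simp add: Poly_Mapping.map.rep_eq when_def dyadic_rat_of_int_def Zero_fract_def)

lemma lookup_rat_extension:
  "Poly_Mapping.lookup (rat_extension \<theta> f) K =
    (\<Sum>J\<in>Poly_Mapping.keys f. Poly_Mapping.lookup f J *
      dyadic_rat_of_int (Poly_Mapping.lookup (\<theta> (Poly_Mapping.single J 1)) K))"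
  by (simp add: rat_extension_def lookup_sum lookup_mconst_mult lookup_map_of_int)

text \<open>Each coefficient of the image is a sum of products bounded by c times the norm of f, and
  by the ultrametric inequality the number of summands does not matter. So bounds on monomials bound
  the whole operator.\<close>

lemma gauss_norm_rat_extension_le:
  assumes "0 \<le> c"
    and c: "\<And>J K. dyadic_int_abs (Poly_Mapping.lookup (\<theta> (Poly_Mapping.single J 1)) K) \<le> c"
  shows "gauss_norm (rat_extension \<theta> f) \<le> c * gauss_norm f"
proof -
  have f: "0 \<le> gauss_norm f" "dyadic_abs (Poly_Mapping.lookup f J) \<le> gauss_norm f" for J
    using gauss_norm_le_iff[of f "gauss_norm f"] by auto
  have "dyadic_abs (Poly_Mapping.lookup f J *
      dyadic_rat_of_int (Poly_Mapping.lookup (\<theta> (Poly_Mapping.single J 1)) K)) \<le> c * gauss_norm f"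
    for J K
    using mult_mono[OF f(2) c f(1) dyadic_int_abs_nonneg, of J J K]
    by (simp add: dyadic_abs_mult dyadic_abs_of_int mult.commute)
  then show ?thesis
    unfolding gauss_norm_le_iff lookup_rat_extension
    using assms(1) f(1) by (auto intro!: dyadic_abs_sum_le)
qed

lemma linear_norm_le:
  assumes "0 \<le> c"
    and "\<And>J K. dyadic_int_abs (Poly_Mapping.lookup (\<theta> (Poly_Mapping.single J 1)) K) \<le> c"
  shows "linear_norm \<theta> \<le> c"
  unfolding linear_norm_def
  by (rule cInf_lower) (use assms gauss_norm_rat_extension_le in \<open>auto intro!: bdd_belowI[of _ 0]\<close>)

text \<open>An infimum below r is undercut by some admissible c < r; testing c on a single monomial,
  whose Gauss norm is at most 1, bounds the coefficients of its image.\<close>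

lemma linear_norm_less_imp:
  assumes "linear_norm \<theta> < r"
  shows "dyadic_int_abs (Poly_Mapping.lookup (\<theta> (Poly_Mapping.single J 1)) K) < r"
proof -
  let ?C = "{c. 0 \<le> c \<and> (\<forall>f. gauss_norm (rat_extension \<theta> f) \<le> c * gauss_norm f)}"
  \<comment> \<open>The set must be nonempty before anything can be inferred from its infimum. The
    constant 1 is admissible because the operator has integral values.\<close>
  have "1 \<in> ?C"
    using gauss_norm_rat_extension_le[of 1 \<theta>] dyadic_int_abs_le_1 by simp
  then obtain c where c: "c \<in> ?C" "c < r"
    using assms cInf_lessD[of ?C r] unfolding linear_norm_def by blast
  let ?g = "Poly_Mapping.single J (1 :: dyadic_rat)"
  have one: "dyadic_abs 1 = 1"
    using dyadic_int_abs_pos[of 1] by (simp add: One_fract_def dyadic_abs_Fract)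
  have "gauss_norm ?g \<le> 1"
    unfolding gauss_norm_le_iff by (simp add: lookup_single when_def one)
  with c(1) have "gauss_norm (rat_extension \<theta> ?g) \<le> c"
    using mult_left_mono[of "gauss_norm ?g" 1 c] by (smt (verit) mem_Collect_eq mult.right_neutral)
  then have "dyadic_abs (Poly_Mapping.lookup (rat_extension \<theta> ?g) K) \<le> c"
    by (simp add: gauss_norm_le_iff)
  then show ?thesis
    using c(2) by (simp add: lookup_rat_extension dyadic_abs_of_int)
qed

section \<open>The \<open>n\<close>-variable polynomials as a module over the Steenrod
  algebra\<close>

section \<open>Steenrod operations are linear and preserve the number of variables\<close>

lemma poly_ring_0 [simp]: "0 \<in> poly_ring n"
  by (simp add: poly_ring_def)

lemma poly_ring_add: "f \<in> poly_ring n \<Longrightarrow> g \<in> poly_ring n \<Longrightarrow> f + g \<in> poly_ring n"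
  using keys_add[of f g] by (auto simp: poly_ring_def)

lemma poly_ring_diff: "f \<in> poly_ring n \<Longrightarrow> g \<in> poly_ring n \<Longrightarrow> f - g \<in> poly_ring n"
  using keys_diff[of f g] by (auto simp: poly_ring_def)

lemma poly_ring_mult:
  assumes "f \<in> poly_ring n" "g \<in> poly_ring n"
  shows "f * g \<in> poly_ring n"
  unfolding poly_ring_def
proof safe
  fix J i
  assume "J \<in> Poly_Mapping.keys (f * g)" and i: "i \<in> Poly_Mapping.keys J"
  then obtain K L where "J = K + L" "K \<in> Poly_Mapping.keys f" "L \<in> Poly_Mapping.keys g"
    using keys_mult[of f g] by blast
  moreover from this have "i \<in> Poly_Mapping.keys K \<union> Poly_Mapping.keys L"
    using i keys_add[of K L] by blast
  ultimately show "i < n"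
    using assms unfolding poly_ring_def by blast
qed

lemma poly_ring_mconst [simp]: "mconst c \<in> poly_ring n"
  by (simp add: poly_ring_def mconst_def)

lemma poly_ring_1 [simp]: "1 \<in> poly_ring n"
  by (simp add: poly_ring_def)

lemma poly_ring_mvar: "i < n \<Longrightarrow> mvar i \<in> poly_ring n"
  by (simp add: poly_ring_def mvar_def)

lemma poly_ring_power: "f \<in> poly_ring n \<Longrightarrow> f ^ k \<in> poly_ring n"
  by (induction k) (simp_all add: poly_ring_mult)

lemma poly_ring_sum: "(\<And>i. i \<in> A \<Longrightarrow> f i \<in> poly_ring n) \<Longrightarrow> (\<Sum>i\<in>A. f i) \<in> poly_ring n"
  by (induction A rule: infinite_finite_induct) (simp_all add: poly_ring_add)

lemma poly_ring_prod: "(\<And>i. i \<in> A \<Longrightarrow> f i \<in> poly_ring n) \<Longrightarrow> (\<Prod>i\<in>A. f i) \<in> poly_ring n"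
  by (induction A rule: infinite_finite_induct) (simp_all add: poly_ring_mult)

lemma poly_ring_Jq_total: "f \<in> poly_ring n \<Longrightarrow> Jq_total f \<in> poly_ring n"
  unfolding Jq_total_def
  by (intro poly_ring_sum poly_ring_mult poly_ring_prod poly_ring_power poly_ring_add poly_ring_mvar
      poly_ring_mconst)
    (auto simp: poly_ring_def simp del: in_keys_iff)

lemma lookup_homogeneous_part:
  "Poly_Mapping.lookup (homogeneous_part d f) J =
    (if mdeg J = d then Poly_Mapping.lookup f J else 0)"
  by (simp add: homogeneous_part_def lookup_sum lookup_single when_def sum.delta in_keys_iff)

lemma homogeneous_part_0 [simp]: "homogeneous_part d 0 = 0"
  by (rule poly_mapping_eqI) (simp add: lookup_homogeneous_part)

lemma homogeneous_part_add: "homogeneous_part d (f + g) = homogeneous_part d f + homogeneous_part d g"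
  by (rule poly_mapping_eqI) (simp add: lookup_homogeneous_part lookup_add)

lemma homogeneous_part_scale: "homogeneous_part d (mconst c * f) = mconst c * homogeneous_part d f"
  by (rule poly_mapping_eqI) (simp add: lookup_homogeneous_part lookup_mconst_mult)

lemma poly_ring_homogeneous_part: "f \<in> poly_ring n \<Longrightarrow> homogeneous_part d f \<in> poly_ring n"
  by (auto simp: poly_ring_def in_keys_iff lookup_homogeneous_part split: if_splits)

lemma Jq_total_0 [simp]: "Jq_total 0 = 0"
  by (simp add: Jq_total_def)

text \<open>Degrees not occurring in f contribute zero, so several polynomials can be summed over
  one common set of degrees. This makes linearity of \<open>Jq\<close> a termwise
  computation.\<close>

lemma Jq_superset:
  assumes "finite D" "mdeg ` Poly_Mapping.keys f \<subseteq> D"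
  shows "Jq k f = (\<Sum>d\<in>D. homogeneous_part (d + k) (Jq_total (homogeneous_part d f)))"
proof -
  have "homogeneous_part d f = 0" if "d \<notin> mdeg ` Poly_Mapping.keys f" for d
    using that by (intro poly_mapping_eqI) (auto simp: lookup_homogeneous_part in_keys_iff)
  then show ?thesis
    unfolding Jq_def using assms by (intro sum.mono_neutral_left) auto
qed

lemma Jq_add: "Jq k (f + g) = Jq k f + Jq k g"
proof -
  let ?D = "mdeg ` (Poly_Mapping.keys f \<union> Poly_Mapping.keys g)"
  have *: "Jq k h = (\<Sum>d\<in>?D. homogeneous_part (d + k) (Jq_total (homogeneous_part d h)))"
    if "Poly_Mapping.keys h \<subseteq> Poly_Mapping.keys f \<union> Poly_Mapping.keys g" for h
    using that by (intro Jq_superset) auto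
  show ?thesis
    by (simp add: * keys_add homogeneous_part_add Jq_total_add sum.distrib)
qed

lemma Jq_scale: "Jq k (mconst c * f) = mconst c * Jq k f"
proof -
  have "mdeg ` Poly_Mapping.keys (mconst c * f) \<subseteq> mdeg ` Poly_Mapping.keys f"
    by (auto simp: in_keys_iff lookup_mconst_mult)
  from Jq_superset[OF _ this] show ?thesis
    by (simp add: Jq_def homogeneous_part_scale Jq_total_mult Jq_total_mconst sum_distrib_left)
qed

lemma poly_ring_Jq: "f \<in> poly_ring n \<Longrightarrow> Jq k f \<in> poly_ring n"
  unfolding Jq_def by (intro poly_ring_sum poly_ring_homogeneous_part poly_ring_Jq_total)

lemma dyadic_steenrod_linear:
  assumes "\<theta> \<in> dyadic_steenrod"
  shows "\<theta> (f + g) = \<theta> f + \<theta> g" "\<theta> (mconst c * f) = mconst c * \<theta> f"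
proof -
  \<comment> \<open>Both laws are quantified over all arguments, so that the composition case can
    apply them to values of the inner operator.\<close>
  from assms have "(\<forall>f g. \<theta> (f + g) = \<theta> f + \<theta> g) \<and> (\<forall>c f. \<theta> (mconst c * f) = mconst c * \<theta> f)"
    by induction (simp_all add: Jq_add Jq_scale distrib_left add_ac mult.left_commute)
  then show "\<theta> (f + g) = \<theta> f + \<theta> g" "\<theta> (mconst c * f) = mconst c * \<theta> f"
    by auto
qed

lemma dyadic_steenrod_poly_ring:
  "\<theta> \<in> dyadic_steenrod \<Longrightarrow> f \<in> poly_ring n \<Longrightarrow> \<theta> f \<in> poly_ring n"
  by (induction arbitrary: f rule: dyadic_steenrod.induct)
    (simp_all add: poly_ring_Jq poly_ring_add poly_ring_mult)

text \<open>By linearity the values on monomials, which are all that \<open>linear_norm\<close>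
  sees, control the values on every polynomial.\<close>

lemma dyadic_steenrod_expand:
  assumes "\<theta> \<in> dyadic_steenrod"
  shows "\<theta> f = (\<Sum>J\<in>Poly_Mapping.keys f. mconst (Poly_Mapping.lookup f J) * \<theta> (Poly_Mapping.single J 1))"
proof -
  have 0: "\<theta> 0 = 0"
    using dyadic_steenrod_linear(1)[OF assms, of 0 0] by (metis add_cancel_right_right add_0)
  have sum: "\<theta> (\<Sum>J\<in>A. g J) = (\<Sum>J\<in>A. \<theta> (g J))" for A :: "multi_index set" and g
    by (induction A rule: infinite_finite_induct) (simp_all add: 0 dyadic_steenrod_linear(1)[OF assms])
  have "f = (\<Sum>J\<in>Poly_Mapping.keys f. mconst (Poly_Mapping.lookup f J) * Poly_Mapping.single J 1)"
    by (subst mpoly_sum_monomials[symmetric]) (simp add: mconst_def mult_single)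
  then have "\<theta> f = \<theta> (\<Sum>J\<in>Poly_Mapping.keys f. mconst (Poly_Mapping.lookup f J) * Poly_Mapping.single J 1)"
    by simp
  then show ?thesis
    by (simp add: sum dyadic_steenrod_linear(2)[OF assms])
qed

section \<open>The submodule spanned by a ball\<close>

lemma linear_ball_dvd:
  assumes "\<theta> \<in> linear_ball (1 / 2 ^ k)"
  shows "2 ^ Suc k dvd Poly_Mapping.lookup (\<theta> f) K"
proof -
  have \<theta>: "\<theta> \<in> dyadic_steenrod" "linear_norm \<theta> < 1 / 2 ^ k"
    using assms by (auto simp: linear_ball_def)
  \<comment> \<open>The strict norm bound and discreteness of the absolute value yield the exponent
    k + 1 on monomials; linearity extends this to f.\<close>
  have "2 ^ Suc k dvd Poly_Mapping.lookup (\<theta> (Poly_Mapping.single J 1)) K" for J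
    using linear_norm_less_imp[OF \<theta>(2)] by (rule dyadic_int_abs_less_imp_dvd)
  then show ?thesis
    by (subst dyadic_steenrod_expand[OF \<theta>(1)])
      (auto simp: lookup_sum lookup_mconst_mult simp del: power_Suc intro!: dvd_sum)
qed

text \<open>A scalar multiple of the identity lies in the algebra, and this one has norm at most
  (1/2) ^ (k + 1). It is the witness that the ball spans every polynomial with the required
  divisibility.\<close>

lemma scaling_in_linear_ball: "(\<lambda>f. mconst (2 ^ Suc k) * f) \<in> linear_ball (1 / 2 ^ k)"
proof -
  have "linear_norm (\<lambda>f. mconst (2 ^ Suc k) * f) \<le> (1 / 2) ^ Suc k"
    by (rule linear_norm_le) (simp_all add: dyadic_int_abs_le_iff lookup_mconst_mult del: power_Suc)
  also have "\<dots> < 1 / 2 ^ k"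
    by (simp add: power_one_over field_simps)
  finally show ?thesis
    unfolding linear_ball_def
    using dyadic_steenrod.scale[OF dyadic_steenrod.id] by simp
qed

lemma mpoly_dvd_factor:
  assumes "f \<in> poly_ring n" "\<And>J. c dvd Poly_Mapping.lookup f J" "c \<noteq> 0"
  obtains g where "g \<in> poly_ring n" "f = mconst c * g"
proof -
  have "\<forall>J. \<exists>q. Poly_Mapping.lookup f J = c * q"
    using assms(2) by (simp add: dvd_def)
  then obtain q where q: "Poly_Mapping.lookup f J = c * q J" for J
    by metis
  \<comment> \<open>As c is nonzero in a domain, dividing by it keeps the support. Hence the
    quotient is again a polynomial, and in the same variables.\<close>
  then have eq: "{J. q J \<noteq> 0} = Poly_Mapping.keys f"
    using assms(3) by (auto simp: in_keys_iff)
  then have g: "Poly_Mapping.lookup (Abs_poly_mapping q) = q"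
    by simp
  have keys: "Poly_Mapping.keys (Abs_poly_mapping q) = Poly_Mapping.keys f"
    using assms(3) by (auto simp: in_keys_iff g q)
  show thesis
  proof
    show "Abs_poly_mapping q \<in> poly_ring n"
      using assms(1) by (simp add: poly_ring_def keys)
    show "f = mconst c * Abs_poly_mapping q"
      by (rule poly_mapping_eqI) (simp add: lookup_mconst_mult g q)
  qed
qed

lemma ball_span_eq:
  "ball_span n k = {f \<in> poly_ring n. \<forall>J. 2 ^ Suc k dvd Poly_Mapping.lookup f J}" (is "_ = ?R")
proof
  have "(\<Sum>(\<theta>, f)\<leftarrow>ps. \<theta> f) \<in> ?R" if "set ps \<subseteq> linear_ball (1 / 2 ^ k) \<times> poly_ring n" for ps
    using that
  proof (induction ps)
    case (Cons p ps)
    obtain \<theta> f where p: "p = (\<theta>, f)"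
      by fastforce
    with Cons have "\<theta> \<in> linear_ball (1 / 2 ^ k)" "f \<in> poly_ring n"
      by auto
    then have "\<theta> f \<in> ?R"
      using linear_ball_dvd dyadic_steenrod_poly_ring by (auto simp: linear_ball_def)
    then show ?case
      using Cons by (simp add: p poly_ring_add lookup_add del: power_Suc)
  qed simp
  then show "ball_span n k \<subseteq> ?R"
    unfolding ball_span_def operator_span_def by blast
next
  show "?R \<subseteq> ball_span n k"
  proof
    fix f
    assume f: "f \<in> ?R"
    \<comment> \<open>This power of 2 is still visible one level higher, in the residue modulo 2 ^
      (k + 2).\<close>
    have "(2 :: dyadic_int) ^ Suc k \<noteq> 0"
    proof
      assume "(2 :: dyadic_int) ^ Suc k = 0"
      then have "residue (2 ^ Suc k) (Suc (Suc k)) = 0"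
        by (simp only: zero_dyadic_int.rep_eq)
      then show False
        by (simp only: residue_power_of_2) simp
    qed
    with f obtain g where g: "g \<in> poly_ring n" "f = mconst (2 ^ Suc k) * g"
      using mpoly_dvd_factor[of f n "2 ^ Suc k"] by blast
    let ?ps = "[(\<lambda>f. mconst (2 ^ Suc k) * f, g)]"
    have "set ?ps \<subseteq> linear_ball (1 / 2 ^ k) \<times> poly_ring n"
      using scaling_in_linear_ball g(1) by simp
    moreover have "f = (\<Sum>(\<theta>, f)\<leftarrow>?ps. \<theta> f)"
      by (simp add: g(2))
    ultimately show "f \<in> ball_span n k"
      unfolding ball_span_def operator_span_def by blast
  qed
qed

section \<open>Cosets of \<open>ball_span\<close> as congruence classes modulo 2 ^ (k + 1)\<close>

section \<open>Residue classes of power series\<close>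

text \<open>Allowing an arbitrary coefficient family a gives cosets of polynomials and
  approximations of power series the same notation. The class is empty if a has no polynomial
  representative at this level.\<close>

definition poly_approx :: "nat \<Rightarrow> nat \<Rightarrow> (multi_index \<Rightarrow> dyadic_int) \<Rightarrow> dyadic_int mpoly set"
  where "poly_approx n k a =
    {f \<in> poly_ring n. \<forall>J. 2 ^ Suc k dvd Poly_Mapping.lookup f J - a J}"

lemma r_coset_ball_span:
  assumes "f \<in> poly_ring n"
  shows "ball_span n k #>\<^bsub>poly_group n\<^esub> f = poly_approx n k (Poly_Mapping.lookup f)"
proof -
  have "g \<in> ball_span n k #>\<^bsub>poly_group n\<^esub> f \<longleftrightarrow> g - f \<in> ball_span n k" for g
    by (auto simp: r_coset_def poly_group_def intro!: bexI[of _ "g - f"])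
  moreover have "g - f \<in> poly_ring n \<longleftrightarrow> g \<in> poly_ring n" for g
    using poly_ring_add[of "g - f" n f] poly_ring_diff[of g n f] assms by auto
  ultimately show ?thesis
    by (auto simp: ball_span_eq poly_approx_def lookup_minus simp del: power_Suc)
qed

lemma poly_approx_cong:
  assumes "\<And>J. 2 ^ Suc k dvd a J - b J"
  shows "poly_approx n k a = poly_approx n k b"
proof -
  have "2 ^ Suc k dvd x - a J \<longleftrightarrow> 2 ^ Suc k dvd x - b J" for x J
    using dvd_add_left_iff[OF assms[of J], of "x - a J"] by (simp del: power_Suc)
  then show ?thesis
    by (simp add: poly_approx_def del: power_Suc)
qed

lemma poly_approx_eq_lookup:
  "f \<in> poly_approx n k a \<Longrightarrow> poly_approx n k a = poly_approx n k (Poly_Mapping.lookup f)"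
  by (rule poly_approx_cong[symmetric]) (simp add: poly_approx_def del: power_Suc)

text \<open>A common representative is congruent to both families. Nonemptiness matters, since two
  families without representatives share the empty class.\<close>

lemma poly_approx_eqD:
  assumes "poly_approx n k a = poly_approx n k b" "poly_approx n k a \<noteq> {}"
  shows "2 ^ Suc k dvd a J - b J"
proof -
  obtain f where "f \<in> poly_approx n k a" "f \<in> poly_approx n k b"
    using assms by auto
  then have "2 ^ Suc k dvd (Poly_Mapping.lookup f J - b J) - (Poly_Mapping.lookup f J - a J)"
    unfolding poly_approx_def by (intro dvd_diff[of _ "_ - _" "_ - _"]) blast+
  then show ?thesis
    by (simp del: power_Suc)
qed

lemma poly_approx_lookup_self: "f \<in> poly_ring n \<Longrightarrow> f \<in> poly_approx n k (Poly_Mapping.lookup f)"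
  by (simp add: poly_approx_def)

lemma poly_approx_antimono: "j \<le> k \<Longrightarrow> poly_approx n k a \<subseteq> poly_approx n j a"
  unfolding poly_approx_def by (auto intro: dvd_trans[OF le_imp_power_dvd] simp del: power_Suc)

text \<open>Each representative at level k also represents a at the coarser level j, so all cosets
  in the union coincide; nonemptiness keeps the union from being empty.\<close>

lemma quotient_projection_poly_approx:
  assumes "poly_approx n k a \<noteq> {}" "j \<le> k"
  shows "quotient_projection n j (poly_approx n k a) = poly_approx n j a"
proof -
  have "ball_span n j #>\<^bsub>poly_group n\<^esub> f = poly_approx n j a" if f: "f \<in> poly_approx n k a" for f
  proof -
    have "f \<in> poly_approx n j a"
      using f poly_approx_antimono[OF assms(2)] by blast
    then show ?thesis
      using poly_approx_eq_lookup r_coset_ball_span by (simp add: poly_approx_def)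
  qed
  then show ?thesis
    using assms(1) by (auto simp: quotient_projection_def)
qed

text \<open>For the harder inclusion, fix any f in the first class: for h in the class of the sum, h
  - f lies in the second.\<close>

lemma set_mult_poly_approx:
  assumes "poly_approx n k a \<noteq> {}"
  shows "poly_approx n k a <#>\<^bsub>poly_group n\<^esub> poly_approx n k b = poly_approx n k (\<lambda>J. a J + b J)"
    (is "?L = ?R")
proof
  have *: "(x + y) - (u + v) = (x - u) + (y - v)" for x y u v :: dyadic_int
    by simp
  show "?L \<subseteq> ?R"
    by (auto simp: set_mult_def poly_group_def poly_approx_def poly_ring_add lookup_add *
        simp del: power_Suc intro!: dvd_add)
  show "?R \<subseteq> ?L"
  proof
    fix h
    assume h: "h \<in> ?R"
    obtain f where f: "f \<in> poly_approx n k a"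
      using assms by blast
    have eq: "x - y - v = (x - (u + v)) - (y - u)" for x y u v :: dyadic_int
      by simp
    have "2 ^ Suc k dvd Poly_Mapping.lookup (h - f) J - b J" for J
      unfolding lookup_minus
      by (subst eq[where u = "a J"], rule dvd_diff) (use f h in \<open>simp_all add: poly_approx_def del: power_Suc\<close>)
    then have "h - f \<in> poly_approx n k b"
      using f h by (simp add: poly_approx_def poly_ring_diff)
    moreover have "h = f + (h - f)"
      by simp
    ultimately show "h \<in> ?L"
      using f unfolding set_mult_def poly_group_def by force
  qed
qed

section \<open>The Tate condition as finiteness modulo every power of 2\<close>

section \<open>The Tate algebra\<close>

text \<open>Every exponent is at most the degree, so these indices inject into the functions from
  {..<n} to {..N} extended by 0. Finiteness of the number of variables enters here.\<close>

lemma finite_multi_index_mdeg_le: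
  "finite {J :: multi_index. Poly_Mapping.keys J \<subseteq> {..<n} \<and> mdeg J \<le> N}"
proof -
  let ?S = "{J :: multi_index. Poly_Mapping.keys J \<subseteq> {..<n} \<and> mdeg J \<le> N}"
  have le: "Poly_Mapping.lookup J i \<le> mdeg J" for J :: multi_index and i
    by (cases "i \<in> Poly_Mapping.keys J") (auto simp: mdeg_def in_keys_iff intro: member_le_sum)
  have "Poly_Mapping.lookup ` ?S \<subseteq> {h. \<forall>i. (i \<in> {..<n} \<longrightarrow> h i \<in> {..N}) \<and> (i \<notin> {..<n} \<longrightarrow> h i = 0)}"
    by (auto simp: in_keys_iff subset_iff intro: le_trans[OF le])
  then have "finite (Poly_Mapping.lookup ` ?S)"
    by (rule finite_subset) (rule finite_set_of_finite_funs; simp)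
  then show ?thesis
    by (rule finite_imageD) (simp add: inj_on_def poly_mapping_eqI)
qed

text \<open>It suffices to test convergence against the powers of 1/2, that is, by divisibility. In
  n variables, degree tending to infinity then means leaving every finite set of indices.\<close>

lemma tate_algebra_iff:
  "a \<in> tate_algebra n \<longleftrightarrow>
    (\<forall>J. a J \<noteq> 0 \<longrightarrow> Poly_Mapping.keys J \<subseteq> {..<n}) \<and> (\<forall>k. finite {J. \<not> 2 ^ k dvd a J})"
  (is "_ \<longleftrightarrow> ?supp \<and> ?fin")
proof -
  have "((\<lambda>J. dyadic_int_abs (a J)) \<longlongrightarrow> 0) (filtercomap mdeg at_top) \<longleftrightarrow>
      (\<forall>e>0. \<exists>N. \<forall>J. N \<le> mdeg J \<longrightarrow> dyadic_int_abs (a J) < e)" (is "?lim \<longleftrightarrow> _")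
    by (simp add: tendsto_iff eventually_filtercomap_at_top_linorder dyadic_int_abs_nonneg)
  also have "\<dots> \<longleftrightarrow> (\<forall>k. \<exists>N. \<forall>J. N \<le> mdeg J \<longrightarrow> 2 ^ k dvd a J)"
  proof safe
    fix k
    assume "\<forall>e>0. \<exists>N. \<forall>J. N \<le> mdeg J \<longrightarrow> dyadic_int_abs (a J) < e"
    then have "\<exists>N. \<forall>J. N \<le> mdeg J \<longrightarrow> dyadic_int_abs (a J) < (1 / 2) ^ k"
      by simp
    then show "\<exists>N. \<forall>J. N \<le> mdeg J \<longrightarrow> 2 ^ k dvd a J"
      using dyadic_int_abs_le_iff less_imp_le by metis
  next
    fix e :: real
    assume *: "\<forall>k. \<exists>N. \<forall>J. N \<le> mdeg J \<longrightarrow> 2 ^ k dvd a J" and "0 < e"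
    then obtain k where "(1 / 2) ^ k < e"
      using real_arch_pow_inv[of e "1 / 2"] by auto
    with * show "\<exists>N. \<forall>J. N \<le> mdeg J \<longrightarrow> dyadic_int_abs (a J) < e"
      using dyadic_int_abs_le_iff le_less_trans by metis
  qed
  finally have lim: "?lim \<longleftrightarrow> (\<forall>k. \<exists>N. \<forall>J. N \<le> mdeg J \<longrightarrow> 2 ^ k dvd a J)" .
  \<comment> \<open>An exceptional index has a nonzero coefficient, so the support condition
    confines it to the first n variables, where bounded degree leaves finitely many. Conversely, a
    finite set of indices has bounded degree.\<close>
  have "(\<exists>N. \<forall>J. N \<le> mdeg J \<longrightarrow> 2 ^ k dvd a J) \<longleftrightarrow> finite {J. \<not> 2 ^ k dvd a J}" if ?supp for k
  proof
    assume "\<exists>N. \<forall>J. N \<le> mdeg J \<longrightarrow> 2 ^ k dvd a J"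
    then obtain N where N: "\<And>J. N \<le> mdeg J \<Longrightarrow> 2 ^ k dvd a J"
      by blast
    have "{J. \<not> 2 ^ k dvd a J} \<subseteq> {J. Poly_Mapping.keys J \<subseteq> {..<n} \<and> mdeg J \<le> N}"
      using that N by (metis (mono_tags, lifting) Collect_mono dvd_0_right nat_le_linear)
    then show "finite {J. \<not> 2 ^ k dvd a J}"
      using finite_multi_index_mdeg_le finite_subset by blast
  next
    assume "finite {J. \<not> 2 ^ k dvd a J}"
    then obtain N where "\<forall>J\<in>{J. \<not> 2 ^ k dvd a J}. mdeg J < N"
      using finite_nat_set_iff_bounded[of "mdeg ` {J. \<not> 2 ^ k dvd a J}"] by auto
    then show "\<exists>N. \<forall>J. N \<le> mdeg J \<longrightarrow> 2 ^ k dvd a J"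
      by (metis (mono_tags, lifting) mem_Collect_eq not_le)
  qed
  then show ?thesis
    unfolding tate_algebra_def mem_Collect_eq lim by blast
qed

lemma tate_algebra_add:
  assumes "a \<in> tate_algebra n" "b \<in> tate_algebra n"
  shows "(\<lambda>J. a J + b J) \<in> tate_algebra n"
proof -
  have "{J. \<not> 2 ^ k dvd a J + b J} \<subseteq> {J. \<not> 2 ^ k dvd a J} \<union> {J. \<not> 2 ^ k dvd b J}" for k
    by auto
  then have "finite {J. \<not> 2 ^ k dvd a J + b J}" for k
    using assms unfolding tate_algebra_iff by (meson finite_Un finite_subset)
  moreover have "\<forall>J. a J + b J \<noteq> 0 \<longrightarrow> Poly_Mapping.keys J \<subseteq> {..<n}"
    using assms unfolding tate_algebra_iff by (metis add.right_neutral)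
  ultimately show ?thesis
    unfolding tate_algebra_iff by blast
qed

lemma tate_group_is_group: "group (tate_group n)"
proof (rule groupI)
  fix a
  assume a: "a \<in> carrier (tate_group n)"
  then have "(\<lambda>J. - a J) \<in> tate_algebra n"
    by (simp add: tate_group_def tate_algebra_iff)
  then show "\<exists>b\<in>carrier (tate_group n). b \<otimes>\<^bsub>tate_group n\<^esub> a = \<one>\<^bsub>tate_group n\<^esub>"
    by (intro bexI[of _ "\<lambda>J. - a J"]) (simp_all add: tate_group_def)
next
  show "\<one>\<^bsub>tate_group n\<^esub> \<in> carrier (tate_group n)"
    by (simp add: tate_group_def tate_algebra_iff)
qed (simp_all add: tate_group_def tate_algebra_add add.assoc)

lemma lookup_in_tate_algebra: "f \<in> poly_ring n \<Longrightarrow> Poly_Mapping.lookup f \<in> tate_algebra n"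
proof -
  assume "f \<in> poly_ring n"
  moreover have "finite {J. \<not> 2 ^ k dvd Poly_Mapping.lookup f J}" for k
    by (rule finite_subset[of _ "Poly_Mapping.keys f"]) (auto simp: in_keys_iff)
  ultimately show ?thesis
    by (auto simp: tate_algebra_iff poly_ring_def in_keys_iff)
qed

text \<open>Dropping every coefficient divisible by 2 ^ (k + 1) leaves finitely many, hence a
  polynomial in the same class.\<close>

lemma poly_approx_tate_nonempty:
  assumes "a \<in> tate_algebra n"
  shows "poly_approx n k a \<noteq> {}"
proof -
  define b where "b J = (if 2 ^ Suc k dvd a J then 0 else a J)" for J
  have "{J. b J \<noteq> 0} \<subseteq> {J. \<not> 2 ^ Suc k dvd a J}"
    by (auto simp: b_def)
  then have "finite {J. b J \<noteq> 0}"
    using assms finite_subset unfolding tate_algebra_iff by blast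
  then have b: "Poly_Mapping.lookup (Abs_poly_mapping b) = b"
    by simp
  have "Abs_poly_mapping b \<in> poly_approx n k a"
    using assms unfolding poly_approx_def poly_ring_def tate_algebra_iff
    by (auto simp: b in_keys_iff b_def split: if_splits)
  then show ?thesis by blast
qed

text \<open>Completeness of the dyadic integers, with an explicit rate of convergence.\<close>

lemma dyadic_int_limit:
  fixes b :: "nat \<Rightarrow> dyadic_int"
  assumes "\<And>j k. j \<le> k \<Longrightarrow> 2 ^ Suc j dvd b k - b j"
  obtains x where "\<And>k. 2 ^ Suc k dvd b k - x"
proof -
  have res: "residue (b k) (Suc j) = residue (b j) (Suc j)" if le: "j \<le> k" for j k
  proof -
    obtain q where "b k - b j = 2 ^ Suc j * q"
      using assms[OF le] unfolding dvd_def by blast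
    then have "b k = b j + 2 ^ Suc j * q"
      by (simp only: diff_eq_eq add.commute)
    then show ?thesis
      by (simp add: plus_dyadic_int.rep_eq times_dyadic_int.rep_eq residue_power_of_2 del: power_Suc)
  qed
  \<comment> \<open>The limit is diagonal: from index k on, the residue of \<open>b\<close> modulo 2
    ^ k no longer changes.\<close>
  define y where "y k = residue (b k) k" for k
  have "y k \<in> {0..<2 ^ k} \<and> y (Suc k) mod 2 ^ k = y k" for k
  proof -
    have "y (Suc k) mod 2 ^ k = residue (b (Suc k)) (Suc k) mod 2 ^ k"
      by (simp add: y_def)
    also have "\<dots> = residue (b k) (Suc k) mod 2 ^ k"
      by (simp only: res[of k "Suc k"] le_SucI order_refl)
    finally show ?thesis
      by (simp add: y_def residue_Suc residue_bounds)
  qed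
  then have y: "residue (Abs_dyadic_int y) = y"
    by (simp add: Abs_dyadic_int_inverse)
  have "2 ^ Suc k dvd b k - Abs_dyadic_int y" for k
  proof -
    \<comment> \<open>\<open>y (Suc k)\<close> is read from \<open>b (Suc k)\<close>; the Cauchy
      hypothesis moves it to \<open>b k\<close> at the same modulus.\<close>
    have "residue (Abs_dyadic_int y) (Suc k) = residue (b k) (Suc k)"
      by (simp only: y y_def res[of k "Suc k"] le_SucI order_refl)
    then have "residue (b k - Abs_dyadic_int y) (Suc k) = residue (b k - b k) (Suc k)"
      by (simp only: diff_conv_add_uminus plus_dyadic_int.rep_eq uminus_dyadic_int.rep_eq)
    then show ?thesis
      by (simp add: power_of_2_dvd_iff zero_dyadic_int.rep_eq del: power_Suc)
  qed
  then show thesis by (rule that)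
qed

section \<open>Compatible families of classes and their limits\<close>

section \<open>The isomorphism\<close>

lemma carrier_completion:
  "x \<in> carrier (completion n) \<longleftrightarrow>
    (\<forall>k. \<exists>f\<in>poly_ring n. x k = poly_approx n k (Poly_Mapping.lookup f)) \<and>
    (\<forall>j k. j \<le> k \<longrightarrow> quotient_projection n j (x k) = x j)"
proof -
  have "C \<in> carrier (poly_group n Mod ball_span n k) \<longleftrightarrow>
      (\<exists>f\<in>poly_ring n. C = poly_approx n k (Poly_Mapping.lookup f))" for C k
    using r_coset_ball_span by (auto simp: carrier_FactGroup poly_group_def)
  then show ?thesis
    by (simp add: completion_def Let_def PiE_UNIV_domain Pi_iff)
qed

lemma mult_completion: "x \<otimes>\<^bsub>completion n\<^esub> y = (\<lambda>k. x k <#>\<^bsub>poly_group n\<^esub> y k)"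
  by (simp add: completion_def Let_def restrict_UNIV)

lemma poly_approx_in_completion:
  assumes "a \<in> tate_algebra n"
  shows "(\<lambda>k. poly_approx n k a) \<in> carrier (completion n)"
  unfolding carrier_completion
proof (intro conjI allI impI)
  fix k
  obtain f where "f \<in> poly_approx n k a"
    using poly_approx_tate_nonempty[OF assms] by blast
  then show "\<exists>f\<in>poly_ring n. poly_approx n k a = poly_approx n k (Poly_Mapping.lookup f)"
    using poly_approx_eq_lookup by (auto simp: poly_approx_def)
qed (use quotient_projection_poly_approx poly_approx_tate_nonempty[OF assms] in blast)

text \<open>Surjectivity: polynomial representatives of the levels have Cauchy coefficients, and
  their coefficientwise limit is the required series.\<close>

lemma completion_eq_poly_approx:
  assumes "x \<in> carrier (completion n)"
  obtains a where "a \<in> tate_algebra n" "x = (\<lambda>k. poly_approx n k a)"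
proof -
  obtain f where f: "\<And>k. f k \<in> poly_ring n" "\<And>k. x k = poly_approx n k (Poly_Mapping.lookup (f k))"
    using assms unfolding carrier_completion by metis
  have "2 ^ Suc j dvd Poly_Mapping.lookup (f k) J - Poly_Mapping.lookup (f j) J" if "j \<le> k" for j k J
  proof (rule poly_approx_eqD)
    have ne: "poly_approx n i (Poly_Mapping.lookup (f k)) \<noteq> {}" for i
      using poly_approx_lookup_self f(1) by blast
    then show "poly_approx n j (Poly_Mapping.lookup (f k)) \<noteq> {}" .
    \<comment> \<open>Projection keeps the representative \<open>f k\<close>, so compatibility makes
      \<open>f k\<close> and \<open>f j\<close> congruent modulo 2 ^ (j + 1).\<close>
    have "poly_approx n j (Poly_Mapping.lookup (f k)) = quotient_projection n j (x k)"
      by (simp add: f(2) quotient_projection_poly_approx ne that)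
    also have "\<dots> = x j"
      using assms that by (simp add: carrier_completion)
    finally show "poly_approx n j (Poly_Mapping.lookup (f k)) = poly_approx n j (Poly_Mapping.lookup (f j))"
      by (simp add: f(2))
  qed
  then have "\<exists>x. \<forall>k. 2 ^ Suc k dvd Poly_Mapping.lookup (f k) J - x" for J
    using dyadic_int_limit[of "\<lambda>k. Poly_Mapping.lookup (f k) J"] by metis
  then obtain a where a: "\<And>J k. 2 ^ Suc k dvd Poly_Mapping.lookup (f k) J - a J"
    by metis
  have dvd: "2 ^ Suc k dvd a J" if "J \<notin> Poly_Mapping.keys (f k)" for J k
    using a[of k J] that by (simp add: in_keys_iff del: power_Suc)
  show thesis
  proof
    show "x = (\<lambda>k. poly_approx n k a)"
      using f(2) poly_approx_cong[OF a] by auto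
    have "Poly_Mapping.keys J \<subseteq> {..<n}" if "a J \<noteq> 0" for J
    proof (rule ccontr)
      assume "\<not> Poly_Mapping.keys J \<subseteq> {..<n}"
      then have "2 ^ Suc k dvd a J" for k
        using f(1)[of k] dvd by (auto simp: poly_ring_def)
      then have "residue (a J) k = 0" for k
        using dvd_mult_right unfolding power_Suc power_of_2_dvd_iff[symmetric] by blast
      then show False
        using that by (metis dyadic_int_eqI zero_dyadic_int.rep_eq)
    qed
    moreover have "finite {J. \<not> 2 ^ k dvd a J}" for k
    proof (rule finite_subset)
      show "{J. \<not> 2 ^ k dvd a J} \<subseteq> Poly_Mapping.keys (f k)"
        using dvd_mult_right[OF dvd[unfolded power_Suc]] by blast
    qed simp
    ultimately show "a \<in> tate_algebra n"
      by (simp add: tate_algebra_iff)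
  qed
qed

lemma tate_iso_completion:
  "(\<lambda>a k. poly_approx n k a) \<in> iso (tate_group n) (completion n)"
proof (rule isoI)
  show "(\<lambda>a k. poly_approx n k a) \<in> hom (tate_group n) (completion n)"
    by (rule homI)
      (auto simp: tate_group_def poly_approx_in_completion mult_completion set_mult_poly_approx
        poly_approx_tate_nonempty)
  have "a = b" if "a \<in> tate_algebra n" and eq: "(\<lambda>k. poly_approx n k a) = (\<lambda>k. poly_approx n k b)"
    for a b
  proof
    fix J
    have "2 ^ Suc k dvd a J - b J" for k
      using poly_approx_eqD[OF fun_cong[OF eq] poly_approx_tate_nonempty[OF that(1)]] .
    then have "residue (a J - b J) k = 0" for k
      using dvd_mult_right unfolding power_Suc power_of_2_dvd_iff[symmetric] by blast
    then have "a J - b J = 0"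
      by (metis dyadic_int_eqI zero_dyadic_int.rep_eq)
    then show "a J = b J"
      by simp
  qed
  then show "bij_betw (\<lambda>a k. poly_approx n k a) (carrier (tate_group n)) (carrier (completion n))"
    unfolding bij_betw_def
    by (auto simp: tate_group_def inj_on_def poly_approx_in_completion elim!: completion_eq_poly_approx)
qed

theorem mainTheorem3:
  fixes n :: nat
  assumes "n \<ge> 1"
  shows "\<exists>\<phi> \<in> iso (completion n) (tate_group n).
    \<forall>f \<in> poly_ring n. \<phi> (to_completion n f) = Poly_Mapping.lookup f"
proof
  let ?\<psi> = "\<lambda>a k. poly_approx n k a"
  let ?\<phi> = "inv_into (carrier (tate_group n)) ?\<psi>"
  interpret group "tate_group n"
    by (rule tate_group_is_group)
  show "?\<phi> \<in> iso (completion n) (tate_group n)"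
    by (rule iso_set_sym) (rule tate_iso_completion)
  have inj: "inj_on ?\<psi> (carrier (tate_group n))"
    using tate_iso_completion[of n] by (simp add: iso_def bij_betw_def)
  show "\<forall>f \<in> poly_ring n. ?\<phi> (to_completion n f) = Poly_Mapping.lookup f"
  proof
    fix f
    assume f: "f \<in> poly_ring n"
    then have "to_completion n f = ?\<psi> (Poly_Mapping.lookup f)"
      by (simp add: to_completion_def r_coset_ball_span)
    moreover have "Poly_Mapping.lookup f \<in> carrier (tate_group n)"
      using f by (simp add: tate_group_def lookup_in_tate_algebra)
    ultimately show "?\<phi> (to_completion n f) = Poly_Mapping.lookup f"
      using inv_into_f_f[OF inj] by simp
  qed
qed

end
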